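(* Let $n = p_1^{k_1} p_2^{k_2} \cdots p_r^{k_r}$ be the prime factorization of a positive integer $n$, with distinct primes $p_i$ and integers $k_i \ge 1$, and let $D = \prod_{i=1}^r (k_i+1)$ be the number of divisors of $n$. Then the hyper-Wiener index of the divisor prime graph $G_{Dp(n)}$ is $$WW(G_{Dp(n)}) = \frac{3D(D-1)}{2} - \prod_{i=1}^r (2k_i+1) + 1.$$
   Context: For a positive integer $n$, the divisor prime graph $G_{Dp(n)}$ is the simple graph whose vertex set is the set of positive divisors of $n$, in which two distinct vertices $x, y$ are adjacent if and only if $\gcd(x,y) = 1$ (no loops). For a connected graph $G$, $d(u,v)$ denotes the shortest-path distance, and the hyper-Wiener index is $WW(G) = \frac{1}{2}\sum_{\{u,v\}} \left(d(u,v) + d(u,v)^2\right)$, the sum over all unordered pairs of distinct vertices. *)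

theory Defs
  imports "Graph_Theory.Graph_Theory" "HOL-Computational_Algebra.Primes"
begin

definition divisor_prime_graph :: "nat \<Rightarrow> nat pair_pre_digraph" where
  "divisor_prime_graph n =
     \<lparr> pverts = {d. d dvd n},
       parcs = {(x, y). x dvd n \<and> y dvd n \<and> x \<noteq> y \<and> gcd x y = 1} \<rparr>"

(* The least length of a walk from u to v: every arc has weight 1.  Unreachable
   pairs have infinite weighted distance, which real_of_ereal sends to 0, so this
   is meaningful only for connected graphs. *)
definition graph_distance :: "('a, 'b) pre_digraph \<Rightarrow> 'a \<Rightarrow> 'a \<Rightarrow> real" where
  "graph_distance G u v = real_of_ereal (wf_digraph.\<mu> G (\<lambda>_. 1) u v)"

(* Undirected graphs are symmetric digraphs, so the distance is symmetric and the
   value for the unordered pair P does not depend on how P is written as {u, v}. *)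
definition pair_distance :: "('a, 'b) pre_digraph \<Rightarrow> 'a set \<Rightarrow> real" where
  "pair_distance G P = (THE d. \<exists>u v. P = {u, v} \<and> d = graph_distance G u v)"

definition hyper_wiener_index :: "('a, 'b) pre_digraph \<Rightarrow> real" where
  "hyper_wiener_index G =
     1 / 2 * (\<Sum>P \<in> {{u, v} | u v. u \<in> verts G \<and> v \<in> verts G \<and> u \<noteq> v}.
                pair_distance G P + (pair_distance G P)\<^sup>2)"

lemma pair_graph_divisor_prime_graph:
  assumes "n > 0"
  shows "pair_graph (divisor_prime_graph n)"
proof -
  have "finite {d. d dvd n}"
    using assms by simp
  moreover have "finite {(x, y). x dvd n \<and> y dvd n \<and> x \<noteq> y \<and> gcd x y = 1}"
    by (rule finite_subset[of _ "{d. d dvd n} \<times> {d. d dvd n}"]) (use assms in auto)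
  ultimately show ?thesis
    by unfold_locales
       (auto simp: divisor_prime_graph_def symmetric_def sym_def gcd.commute)
qed

lemma connected_divisor_prime_graph:
  assumes "n > 0"
  shows "connected (divisor_prime_graph n)"
proof -
  interpret pair_graph "divisor_prime_graph n"
    by (rule pair_graph_divisor_prime_graph[OF assms])
  let ?G = "with_proj (divisor_prime_graph n)"
  have one: "1 \<in> pverts (divisor_prime_graph n)"
    by (simp add: divisor_prime_graph_def)
  have to_1: "u \<rightarrow>\<^sup>*\<^bsub>?G\<^esub> 1" if u: "u \<in> pverts (divisor_prime_graph n)" for u
  proof (cases "u = 1")
    case True
    then show ?thesis using reachable_refl[OF one] by simp
  next
    case False
    then have "u \<rightarrow>\<^bsub>?G\<^esub> 1" using u by (simp add: divisor_prime_graph_def)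
    then show ?thesis by (rule wf_digraph.reachable_adjI[OF wf_digraph])
  qed
  have "u \<rightarrow>\<^sup>*\<^bsub>?G\<^esub> v"
    if "u \<in> pverts (divisor_prime_graph n)" "v \<in> pverts (divisor_prime_graph n)" for u v
    using that by (blast intro: reachable_trans to_1 symmetric_reachable[OF sym_arcs])
  then have "u \<rightarrow>\<^sup>*\<^bsub>mk_symmetric ?G\<^esub> v"
    if "u \<in> pverts (divisor_prime_graph n)" "v \<in> pverts (divisor_prime_graph n)" for u v
    using that by (blast intro: wf_digraph.reachable_mk_symmetricI[OF wf_digraph])
  then show ?thesis
    using one by (auto simp: connected_def intro!: strongly_connectedI)
qed

end

theory Submission
  imports Defs
begin

text \<open>
  Since 1 is adjacent to every other divisor, two distinct divisors are at distance 1 if they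
  are coprime and at distance 2 otherwise. With \<open>m\<close> edges this gives
  \<open>WW = (6 (D choose 2) - 4 m) / 2\<close>. The number \<open>2 m + 1\<close> of ordered pairs of coprime divisors
  (the extra one being \<open>(1, 1)\<close>) is multiplicative in \<open>n\<close> and equals \<open>2 k + 1\<close> at a prime power
  \<open>p ^ k\<close>.
\<close>

section \<open>Counting divisors and coprime pairs of divisors\<close>

definition coprime_divisor_pairs :: "nat \<Rightarrow> (nat \<times> nat) set" where
  "coprime_divisor_pairs n = {(x, y). x dvd n \<and> y dvd n \<and> coprime x y}"

lemma finite_coprime_divisor_pairs:
  assumes "n > 0"
  shows "finite (coprime_divisor_pairs n)"
  by (rule finite_subset[of _ "{d. d dvd n} \<times> {d. d dvd n}"])
     (use assms in \<open>auto simp: coprime_divisor_pairs_def\<close>)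

text \<open>This is the injectivity behind both multiplicativity bijections below. If the products
  agree, \<open>x\<close> divides \<open>x' * y'\<close> and is coprime to \<open>y'\<close>, hence
  divides \<open>x'\<close>; the other divisibilities follow in the same way.\<close>

lemma coprime_dvd_mult_eq_iff:
  fixes a b :: nat
  assumes "coprime a b" "x dvd a" "x' dvd a" "y dvd b" "y' dvd b"
  shows "x * y = x' * y' \<longleftrightarrow> x = x' \<and> y = y'"
proof -
  have "coprime x y'" "coprime x' y"
    using assms by (meson coprime_divisors)+
  then show ?thesis
    using coprime_crossproduct_nat[of x y' x' y] by (auto simp: coprime_commute)
qed

text \<open>By \<open>division_decomp\<close> every divisor of \<open>a * b\<close> is a divisor of
  \<open>a\<close> times a divisor of \<open>b\<close>, and coprimality makes this splitting
  unique.\<close>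

lemma card_divisors_mult:
  fixes a b :: nat
  assumes "coprime a b"
  shows "card {d. d dvd a * b} = card {d. d dvd a} * card {d. d dvd b}"
proof -
  have "bij_betw (\<lambda>(x, y). x * y) ({d. d dvd a} \<times> {d. d dvd b}) {d. d dvd a * b}"
    unfolding bij_betw_def
  proof
    show "inj_on (\<lambda>(x, y). x * y) ({d. d dvd a} \<times> {d. d dvd b})"
      by (rule inj_onI) (clarsimp simp: coprime_dvd_mult_eq_iff[OF assms])
    show "(\<lambda>(x, y). x * y) ` ({d. d dvd a} \<times> {d. d dvd b}) = {d. d dvd a * b}"
      by (auto simp: image_iff mult_dvd_mono dest: division_decomp)
  qed
  from bij_betw_same_card[OF this] show ?thesis
    by (simp add: card_cartesian_product)
qed

text \<open>Multiplication is applied in each component. The pair \<open>(x * x', y * y')\<close> is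
  coprime iff all four cross pairs are; two of them, \<open>x\<close> with \<open>y'\<close> and
  \<open>x'\<close> with \<open>y\<close>, are automatic because \<open>a\<close> and
  \<open>b\<close> are coprime.\<close>

lemma card_coprime_divisor_pairs_mult:
  assumes "coprime a b"
  shows "card (coprime_divisor_pairs (a * b)) =
           card (coprime_divisor_pairs a) * card (coprime_divisor_pairs b)"
proof -
  let ?f = "\<lambda>((x, y), (x', y')). (x * x', y * y') :: nat \<times> nat"
  have "bij_betw ?f (coprime_divisor_pairs a \<times> coprime_divisor_pairs b)
          (coprime_divisor_pairs (a * b))"
    unfolding bij_betw_def
  proof
    show "inj_on ?f (coprime_divisor_pairs a \<times> coprime_divisor_pairs b)"
      by (rule inj_onI)
         (clarsimp simp: coprime_divisor_pairs_def coprime_dvd_mult_eq_iff[OF assms])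
    have "(x * x', y * y') \<in> coprime_divisor_pairs (a * b)"
      if "(x, y) \<in> coprime_divisor_pairs a" "(x', y') \<in> coprime_divisor_pairs b" for x y x' y'
      using that coprime_divisors[OF _ _ assms, of x y'] coprime_divisors[OF _ _ assms, of y x']
      by (simp add: coprime_divisor_pairs_def mult_dvd_mono coprime_commute)
    moreover have "(x, y) \<in> ?f ` (coprime_divisor_pairs a \<times> coprime_divisor_pairs b)"
      if "(x, y) \<in> coprime_divisor_pairs (a * b)" for x y
    proof -
      from that have dvd: "x dvd a * b" "y dvd a * b" and cop: "coprime x y"
        by (simp_all add: coprime_divisor_pairs_def)
      obtain x1 x2 y1 y2 where x: "x = x1 * x2" "x1 dvd a" "x2 dvd b"
        and y: "y = y1 * y2" "y1 dvd a" "y2 dvd b"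
        using dvd by (meson division_decomp)
      with cop have "((x1, y1), (x2, y2)) \<in> coprime_divisor_pairs a \<times> coprime_divisor_pairs b"
        by (auto simp: coprime_divisor_pairs_def)
      then show ?thesis
        by (rule rev_image_eqI) (simp add: x y)
    qed
    ultimately show "?f ` (coprime_divisor_pairs a \<times> coprime_divisor_pairs b) =
                       coprime_divisor_pairs (a * b)"
      by (intro subset_antisym subrelI image_subsetI) (simp_all add: case_prod_beta mem_Times_iff)
  qed
  from bij_betw_same_card[OF this] show ?thesis
    by (simp add: card_cartesian_product)
qed

lemma card_divisors_prime_power:
  fixes p :: nat
  assumes "prime p"
  shows "card {d. d dvd p ^ k} = k + 1"
proof -
  have "inj_on (\<lambda>i. p ^ i) {..k}"
    using prime_gt_1_nat[OF assms] by (auto intro: inj_onI)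
  moreover have "{d. d dvd p ^ k} = (\<lambda>i. p ^ i) ` {..k}"
    by (auto simp: divides_primepow_nat[OF assms])
  ultimately show ?thesis
    by (simp add: card_image)
qed

text \<open>Two powers of \<open>p\<close> are coprime only if one of them is 1.\<close>

lemma card_coprime_divisor_pairs_prime_power:
  assumes "prime p"
  shows "card (coprime_divisor_pairs (p ^ k)) = 2 * k + 1"
proof -
  have p: "p > 1" using prime_gt_1_nat[OF assms] .
  have inj: "inj_on (\<lambda>i. (p ^ i, 1 :: nat)) {..k}" "inj_on (\<lambda>i. (1 :: nat, p ^ i)) {1..k}"
    using p by (auto intro!: inj_onI)
  have "coprime (p ^ i) (p ^ j) \<longleftrightarrow> i = 0 \<or> j = 0" for i j
    using p by (cases "i = 0"; cases "j = 0") auto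
  note cop = this
  \<comment> \<open>The second family starts at exponent 1, so that \<open>(1, 1)\<close> is counted
    once and the sizes add up to \<open>(k + 1) + k\<close>.\<close>
  have "coprime_divisor_pairs (p ^ k) = (\<lambda>i. (p ^ i, 1)) ` {..k} \<union> (\<lambda>i. (1, p ^ i)) ` {1..k}"
    (is "?C = ?A \<union> ?B")
  proof
    show "?C \<subseteq> ?A \<union> ?B"
    proof clarify
      fix x y assume "(x, y) \<in> ?C" "(x, y) \<notin> ?B"
      then obtain i j where "x = p ^ i" "i \<le> k" "y = p ^ j" "j \<le> k" "i = 0 \<or> j = 0"
        unfolding coprime_divisor_pairs_def mem_Collect_eq prod.case
          divides_primepow_nat[OF assms] using cop by metis
      with \<open>(x, y) \<notin> ?B\<close> show "(x, y) \<in> ?A"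
        by (cases "j = 0") auto
    qed
    show "?A \<union> ?B \<subseteq> ?C"
      by (auto simp: coprime_divisor_pairs_def le_imp_power_dvd)
  qed
  moreover have "1 < p ^ i" if "i \<in> {1..k}" for i
    using that p by (intro one_less_power) auto
  then have "(\<lambda>i. (p ^ i, 1)) ` {..k} \<inter> (\<lambda>i. (1, p ^ i)) ` {1..k} = {}"
    by fastforce
  ultimately show ?thesis
    using inj by (simp add: card_Un_disjoint card_image)
qed

text \<open>Both counts follow by induction on the index set: coprimality splits off one prime
  power, whose count is known.\<close>

lemma card_divisors_prod_prime_powers:
  fixes p :: "'i \<Rightarrow> nat"
  assumes "finite I" "inj_on p I" "\<And>i. i \<in> I \<Longrightarrow> prime (p i)"
  shows "card {d. d dvd (\<Prod>i\<in>I. p i ^ k i)} = (\<Prod>i\<in>I. k i + 1)"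
    and "card (coprime_divisor_pairs (\<Prod>i\<in>I. p i ^ k i)) = (\<Prod>i\<in>I. 2 * k i + 1)"
  using assms
proof (induction I rule: finite_induct)
  case empty
  case 1 show ?case by simp
  case 2
  have "coprime_divisor_pairs 1 = {(1, 1)}"
    by (auto simp: coprime_divisor_pairs_def)
  then show ?case by simp
next
  case (insert j I)
  \<comment> \<open>Injectivity of \<open>p\<close> makes \<open>p j\<close> a prime different from
    all \<open>p i\<close> with \<open>i\<close> in \<open>I\<close>. The hypotheses are restated
    because each of the two goals of the induction carries its own copy of them.\<close>
  have "coprime (p j ^ k j) (\<Prod>i\<in>I. p i ^ k i)" if "inj_on p (insert j I)"
    "\<And>i. i \<in> insert j I \<Longrightarrow> prime (p i)"
    using that insert.hyps by (intro prod_coprime_right coprime_power_left_iff[THEN iffD2]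
        coprime_power_right_iff[THEN iffD2] disjI1 primes_coprime) (auto simp: image_iff)
  note cop = this
  case 1
  with insert cop[OF 1] show ?case
    by (simp add: card_divisors_mult card_divisors_prime_power)
  case 2
  with insert cop[OF 2] show ?case
    by (simp add: card_coprime_divisor_pairs_mult card_coprime_divisor_pairs_prime_power)
qed

section \<open>Distances one and two under unit weights\<close>

context wf_digraph
begin

lemma awalk_cost_one: "awalk_cost (\<lambda>_. 1) p = real (length p)"
  by (induction p) (auto simp: awalk_cost_def)

text \<open>\<open>\<mu>\<close> is the infimum of the costs of all walks from \<open>u\<close> to
  \<open>v\<close>. Under unit weights the cost is the length, so a shortest walk attains the
  infimum.\<close>

lemma mu_one_eq_length:
  assumes "awalk u p v" "\<And>q. awalk u q v \<Longrightarrow> length p \<le> length q"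
  shows "\<mu> (\<lambda>_. 1) u v = ereal (length p)"
  unfolding \<mu>_def using assms by (intro INF_eqI) (auto simp: awalk_cost_one)

lemma graph_distance_adj:
  assumes "u \<noteq> v" "u \<rightarrow> v"
  shows "graph_distance G u v = 1"
proof -
  obtain e where "e \<in> arcs G" "tail G e = u" "head G e = v"
    using assms(2) by auto
  then have "awalk u [e] v"
    using arc_implies_awalk by auto
  moreover have "length [e] \<le> length q" if "awalk u q v" for q
    using that assms(1) by (cases q) (auto simp: awalk_Nil_iff)
  ultimately show ?thesis
    using mu_one_eq_length[of u "[e]" v] by (simp add: graph_distance_def)
qed

lemma graph_distance_common_neighbour:
  assumes "u \<noteq> v" "\<not> u \<rightarrow> v" "u \<rightarrow> w" "w \<rightarrow> v"
  shows "graph_distance G u v = 2"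
proof -
  obtain e where "e \<in> arcs G" "tail G e = u" "head G e = w"
    using assms(3) by auto
  moreover obtain f where "f \<in> arcs G" "tail G f = w" "head G f = v"
    using assms(4) by auto
  ultimately have "awalk u [e, f] v"
    by (auto simp: awalk_simps)
  \<comment> \<open>The empty walk would force \<open>u = v\<close>, and a walk with one arc would
    make \<open>u\<close> adjacent to \<open>v\<close>.\<close>
  moreover have "length [e, f] \<le> length q" if "awalk u q v" for q
  proof (cases q)
    case Nil
    with that assms(1) show ?thesis by (simp add: awalk_Nil_iff)
  next
    case (Cons a q')
    with that assms(2) show ?thesis
      by (cases q') (auto simp: awalk_simps in_arcs_imp_in_arcs_ends)
  qed
  ultimately show ?thesis
    using mu_one_eq_length[of u "[e, f]" v] by (simp add: graph_distance_def)
qed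

end

section \<open>From distances to the hyper-Wiener index\<close>

lemma sum_unordered_pairs:
  fixes f :: "'a set \<Rightarrow> real"
  assumes "finite V"
  shows "2 * (\<Sum>P \<in> {{u, v} | u v. u \<in> V \<and> v \<in> V \<and> u \<noteq> v}. f P) =
           (\<Sum>(u, v) \<in> {(u, v). u \<in> V \<and> v \<in> V \<and> u \<noteq> v}. f {u, v})"
proof -
  let ?R = "{(u, v). u \<in> V \<and> v \<in> V \<and> u \<noteq> v}"
  let ?E = "{{u, v} | u v. u \<in> V \<and> v \<in> V \<and> u \<noteq> v}"
  let ?g = "\<lambda>(u, v). {u, v}"
  have fin: "finite ?R"
    by (rule finite_subset[of _ "V \<times> V"]) (use assms in auto)
  have E: "?g ` ?R = ?E" by (auto simp: image_iff)
  have "(\<Sum>(u, v) \<in> ?R. f {u, v}) = (\<Sum>r \<in> ?R. f (?g r))"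
    by (intro sum.cong) auto
  \<comment> \<open>Ordered pairs are grouped by their underlying set; off the diagonal every fibre
    has exactly two elements.\<close>
  also have "\<dots> = (\<Sum>P \<in> ?g ` ?R. \<Sum>r \<in> {r \<in> ?R. ?g r = P}. f (?g r))"
    by (rule sum.image_gen[OF fin])
  also have "\<dots> = (\<Sum>P \<in> ?g ` ?R. 2 * f P)"
  proof (intro sum.cong refl)
    fix P assume "P \<in> ?g ` ?R"
    then obtain u v where P: "P = {u, v}" "u \<in> V" "v \<in> V" "u \<noteq> v" by auto
    then have "{r \<in> ?R. ?g r = P} = {(u, v), (v, u)}"
      by (auto simp: doubleton_eq_iff)
    with P show "(\<Sum>r \<in> {r \<in> ?R. ?g r = P}. f (?g r)) = 2 * f P"
      by (simp add: insert_commute)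
  qed
  finally show ?thesis
    unfolding E by (simp add: sum_distrib_left)
qed

text \<open>The set \<open>{u, v}\<close> can be written only with \<open>u, v\<close> or
  \<open>v, u\<close>, so symmetry makes the value in the definite description unique.\<close>

lemma pair_distance_eq:
  assumes "graph_distance G u v = graph_distance G v u"
  shows "pair_distance G {u, v} = graph_distance G u v"
  unfolding pair_distance_def
  by (rule the_equality) (use assms in \<open>auto simp: doubleton_eq_iff\<close>)

lemma graph_distance_divisor_prime_graph:
  assumes "n > 0" "u dvd n" "v dvd n" "u \<noteq> v"
  shows "graph_distance (divisor_prime_graph n) u v = (if coprime u v then 1 else 2)"
proof -
  interpret pair_graph "divisor_prime_graph n"
    by (rule pair_graph_divisor_prime_graph[OF assms(1)])
  let ?G = "with_proj (divisor_prime_graph n)"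
  have adj: "x \<rightarrow>\<^bsub>?G\<^esub> y \<longleftrightarrow>
               x dvd n \<and> y dvd n \<and> x \<noteq> y \<and> coprime x y" for x y
    by (auto simp: divisor_prime_graph_def coprime_iff_gcd_eq_1)
  show ?thesis
  proof (cases "coprime u v")
    case True
    with adj assms have "u \<rightarrow>\<^bsub>?G\<^esub> v" by blast
    from wf_digraph.graph_distance_adj[OF wf_digraph assms(4) this] True show ?thesis
      by simp
  next
    case False
    \<comment> \<open>Since 1 is coprime to everything, neither vertex is 1, and 1 serves as their
      common neighbour.\<close>
    then have "u \<noteq> 1" "v \<noteq> 1" by auto
    with adj assms have "u \<rightarrow>\<^bsub>?G\<^esub> 1" "1 \<rightarrow>\<^bsub>?G\<^esub> v" by simp_all
    moreover have "\<not> u \<rightarrow>\<^bsub>?G\<^esub> v" using adj False by blast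
    ultimately show ?thesis
      using wf_digraph.graph_distance_common_neighbour[OF wf_digraph assms(4)] False by simp
  qed
qed

lemma hyper_wiener_index_divisor_prime_graph:
  assumes "n > 0"
  shows "hyper_wiener_index (divisor_prime_graph n) =
           3 * real (card {d. d dvd n}) * (real (card {d. d dvd n}) - 1) / 2
             - real (card (coprime_divisor_pairs n)) + 1"
proof -
  let ?G = "with_proj (divisor_prime_graph n)"
  let ?V = "{d. d dvd n}"
  let ?R = "{(u, v). u \<in> ?V \<and> v \<in> ?V \<and> u \<noteq> v}"
  let ?C = "coprime_divisor_pairs n"
  have finV: "finite ?V" using assms by simp
  have finR: "finite ?R"
    by (rule finite_subset[of _ "?V \<times> ?V"]) (use finV in auto)
  have "?R = ?V \<times> ?V - (\<lambda>d. (d, d)) ` ?V" by auto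
  moreover have "card ((\<lambda>d. (d, d)) ` ?V) = card ?V"
    by (rule card_image) (auto intro: inj_onI)
  \<comment> \<open>This makes the natural-number subtraction in the size of the set difference
    exact when it is moved to the reals.\<close>
  moreover have "card ?V \<le> card ?V * card ?V" by simp
  ultimately have cardR: "real (card ?R) = real (card ?V) * (real (card ?V) - 1)"
    using finV by (subst \<open>?R = _\<close>, subst card_Diff_subset)
      (auto simp: card_cartesian_product of_nat_diff algebra_simps)
  \<comment> \<open>A number coprime to itself is 1, so discarding the diagonal removes exactly one
    coprime pair.\<close>
  have C: "?C \<inter> ?R = ?C - {(1, 1)}" and one: "(1, 1) \<in> ?C"
    by (auto simp: coprime_divisor_pairs_def)
  then have cardC: "real (card (?C \<inter> ?R)) = real (card ?C) - 1"
    using card_Suc_Diff1[OF finite_coprime_divisor_pairs[OF assms] one] by simp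
  \<comment> \<open>Distance 1 contributes 1 + 1 = 2 and distance 2 contributes 2 + 4 = 6, so
    coprimality lowers the term by 4.\<close>
  have pd: "pair_distance ?G {u, v} + (pair_distance ?G {u, v})\<^sup>2 =
              6 - 4 * of_bool ((u, v) \<in> ?C)" if "(u, v) \<in> ?R" for u v
    using that assms
    by (subst (1 2) pair_distance_eq)
       (auto simp: graph_distance_divisor_prime_graph coprime_divisor_pairs_def coprime_commute)
  have verts: "verts ?G = ?V" by (simp add: divisor_prime_graph_def)
  \<comment> \<open>One factor 2 cancels the 1/2 in the index, the other comes from passing to
    ordered pairs.\<close>
  have "4 * hyper_wiener_index ?G =
          (\<Sum>(u, v) \<in> ?R. pair_distance ?G {u, v} + (pair_distance ?G {u, v})\<^sup>2)"
    unfolding hyper_wiener_index_def verts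
    using sum_unordered_pairs[OF finV, of "\<lambda>P. pair_distance ?G P + (pair_distance ?G P)\<^sup>2"]
    by linarith
  also have "\<dots> = (\<Sum>r \<in> ?R. 6 - 4 * of_bool (r \<in> ?C))"
    by (intro sum.cong refl) (use pd in auto)
  also have "\<dots> = 6 * real (card ?R) - 4 * real (card (?C \<inter> ?R))"
    using finR by (simp add: sum_subtractf flip: sum_distrib_left) (simp add: Int_commute Int_def)
  \<comment> \<open>Dividing by 4 turns 6 into 3/2; the final \<open>+ 1\<close> comes from the
    removed pair \<open>(1, 1)\<close>.\<close>
  finally show ?thesis
    unfolding cardR cardC by (simp add: field_simps)
qed

theorem theorem3p3:
  fixes n r D :: nat and p k :: "nat \<Rightarrow> nat"
  assumes "\<And>i. i \<in> {1..r} \<Longrightarrow> prime (p i)"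
    and "inj_on p {1..r}"
    and "\<And>i. i \<in> {1..r} \<Longrightarrow> k i \<ge> 1"
    and "n = (\<Prod>i=1..r. p i ^ k i)"
    and "D = (\<Prod>i=1..r. (k i + 1))"
  shows "hyper_wiener_index (divisor_prime_graph n) =
           3 * real D * (real D - 1) / 2 - real (\<Prod>i=1..r. (2 * k i + 1)) + 1"
proof -
  have "n > 0"
    unfolding assms(4) using assms(1) by (intro prod_pos) (simp add: prime_gt_0_nat)
  moreover have "card {d. d dvd n} = D"
    unfolding assms(4,5) by (rule card_divisors_prod_prime_powers) (use assms(1,2) in auto)
  moreover have "card (coprime_divisor_pairs n) = (\<Prod>i=1..r. (2 * k i + 1))"
    unfolding assms(4) by (rule card_divisors_prod_prime_powers) (use assms(1,2) in auto)
  ultimately show ?thesis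
    by (simp only: hyper_wiener_index_divisor_prime_graph)
qed

end
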